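(* Let $\phi$ be a state of $M_n(\mathbb{C})$ with density operator $Q_\phi=\sum_{i=1}^n\lambda_i e_i$, where $\lambda=(\lambda_1\ge\lambda_2\ge\cdots\ge\lambda_n)$ are the eigenvalues of $Q_\phi$ and $e_1,\dots,e_n$ are mutually orthogonal minimal projections of $M_n(\mathbb{C})$ (fixed). Let $\{e_{kl}\}_{k,l=1}^n$ be a system of matrix units of $M_n(\mathbb{C})$ with $e_{ii}=e_i$ for all $i$, and represent every $x\in M_n(\mathbb{C})$ as a matrix $(x(k,l))_{k,l}$ with respect to $\{e_{kl}\}$, so that the maximal abelian subalgebra $D$ generated by $e_1,\dots,e_n$ is the algebra of diagonal matrices. Let $u\in M_n(\mathbb{C})$ be a unitary and let $b(u)$ be the matrix with entries $b(u)(i,j)=|u(i,j)|^2$. Then $$h_\phi(D\mid uDu^* )=H_\lambda(b(u)^* )+S(\phi|_D)-S(\phi|_{uDu^*}).$$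
   Context: Let $\eta(t)=-t\log t$ for $t>0$ and $\eta(0)=0$. A subalgebra of $M_n(\mathbb{C})$ means a unital *-subalgebra. For a finite-dimensional *-algebra $C$ of matrices, $\mathrm{Tr}$ denotes the canonical trace on $C$, i.e. $\mathrm{Tr}(p)=1$ for every minimal projection $p\in C$. For a positive linear functional $\psi$ on $C$, its density operator $Q_\psi\in C$ is the unique positive operator with $\psi(x)=\mathrm{Tr}(Q_\psi x)$ for $x\in C$, and its von Neumann entropy is $S(\psi)=\mathrm{Tr}(\eta(Q_\psi))$. For positive linear functionals $\psi,\varphi$ on $C$ with $\psi\le c\,\varphi$ for some $c>0$, the relative entropy is $S(\psi,\varphi)=\mathrm{Tr}(Q_\psi(\log Q_\psi-\log Q_\varphi))$ (with the usual conventions on kernels, $0\log 0=0$). Let $\tau$ be the normalized trace of $M_n(\mathbb{C})$, and for a subalgebra $A$ let $E_A$ be the $\tau$-preserving conditional expectation of $M_n(\mathbb{C})$ onto $A$. For a state $\phi$ and subalgebras $A,B$ of $M_n(\mathbb{C})$, the conditional relative entropy of $A$ and $B$ with respect to $\phi$ conditioned by $A$ is $$h_\phi(A\mid B)=\sup_{(\phi_i)}\sum_i\Big(S(\phi_i|_A,\phi|_A)-S\big((\phi_i\circ E_A)|_B,(\phi\circ E_A)|_B\big)\Big),$$ where the supremum is over all finite families $(\phi_i)$ of positive linear functionals on $M_n(\mathbb{C})$ with $\sum_i\phi_i=\phi$. For a bistochastic matrix $b=(b(i,j))\in M_n(\mathbb{C})$ (nonnegative entries, all row sums and column sums equal to $1$)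 and a probability vector $\lambda=(\lambda_1,\dots,\lambda_n)$, the weighted entropy is $H_\lambda(b)=\sum_{k=1}^n\lambda_k\sum_{j=1}^n\eta(b(j,k))$. Here $b^*$ is the conjugate transpose (so the transpose) of $b$. *)

theory Defs
  imports "HOL-Analysis.Analysis"
begin

type_synonym 'n cmat = "((complex, 'n) vec, 'n) vec"

definition cscale :: "complex \<Rightarrow> 'n::finite cmat \<Rightarrow> 'n cmat"  (infixr "*\<^sub>C" 75) where
  "c *\<^sub>C x = map_matrix ((*) c) x"

definition adj :: "'n::finite cmat \<Rightarrow> 'n cmat" where
  "adj x = (\<chi> i j. cnj (x $ j $ i))"

definition is_unitary :: "'n::finite cmat \<Rightarrow> bool" where
  "is_unitary u \<longleftrightarrow> adj u ** u = mat 1 \<and> u ** adj u = mat 1"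

definition psd :: "'n::finite cmat \<Rightarrow> bool" where
  "psd x \<longleftrightarrow> (\<forall>v. (\<Sum>i\<in>UNIV. cnj (v $ i) * (x *v v) $ i) \<in> \<real>\<^sub>\<ge>\<^sub>0)"

definition unitary_conj :: "'n::finite cmat \<Rightarrow> 'n cmat set \<Rightarrow> 'n cmat set" where
  "unitary_conj u C = (\<lambda>x. u ** x ** adj u) ` C"

definition is_projection :: "'n::finite cmat \<Rightarrow> bool" where
  "is_projection p \<longleftrightarrow> p ** p = p \<and> adj p = p"

definition star_subalgebra :: "'n::finite cmat set \<Rightarrow> bool" where
  "star_subalgebra C \<longleftrightarrow> mat 1 \<in> C
     \<and> (\<forall>x\<in>C. \<forall>y\<in>C. x + y \<in> C \<and> x ** y \<in> C)
     \<and> (\<forall>c. \<forall>x\<in>C. c *\<^sub>C x \<in> C)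
     \<and> (\<forall>x\<in>C. adj x \<in> C)"

text \<open>For projections, \<open>p ** q = q\<close> expresses \<open>q \<le> p\<close>.\<close>

definition minimal_projection :: "'n::finite cmat set \<Rightarrow> 'n cmat \<Rightarrow> bool" where
  "minimal_projection C p \<longleftrightarrow> p \<in> C \<and> is_projection p \<and> p \<noteq> 0
     \<and> (\<forall>q\<in>C. is_projection q \<and> p ** q = q \<longrightarrow> q = 0 \<or> q = p)"

text \<open>
  A functional on a subalgebra \<open>C\<close> is a function on all matrices of which only the values on \<open>C\<close>
  are used. The restriction of \<open>\<psi>\<close> to \<open>C\<close> is therefore \<open>\<psi>\<close> itself, together with the argument \<open>C\<close>.
\<close>

definition linear_functional :: "'n::finite cmat set \<Rightarrow> ('n cmat \<Rightarrow> complex) \<Rightarrow> bool" where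
  "linear_functional C f \<longleftrightarrow> (\<forall>x\<in>C. \<forall>y\<in>C. f (x + y) = f x + f y)
     \<and> (\<forall>c. \<forall>x\<in>C. f (c *\<^sub>C x) = c * f x)"

definition positive_functional :: "'n::finite cmat set \<Rightarrow> ('n cmat \<Rightarrow> complex) \<Rightarrow> bool" where
  "positive_functional C f \<longleftrightarrow> linear_functional C f \<and> (\<forall>x\<in>C. f (adj x ** x) \<in> \<real>\<^sub>\<ge>\<^sub>0)"

definition is_state :: "('n::finite cmat \<Rightarrow> complex) \<Rightarrow> bool" where
  "is_state f \<longleftrightarrow> positive_functional UNIV f \<and> f (mat 1) = 1"

text \<open>
  The trace below is unique on \<open>C\<close>, since the minimal projections of \<open>C\<close> span \<open>C\<close>; its values
  outside \<open>C\<close> are arbitrary and never used.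
\<close>

definition is_canonical_trace :: "'n::finite cmat set \<Rightarrow> ('n cmat \<Rightarrow> complex) \<Rightarrow> bool" where
  "is_canonical_trace C T \<longleftrightarrow> linear_functional C T
     \<and> (\<forall>x\<in>C. \<forall>y\<in>C. T (x ** y) = T (y ** x))
     \<and> (\<forall>p. minimal_projection C p \<longrightarrow> T p = 1)"

definition canonical_trace :: "'n::finite cmat set \<Rightarrow> 'n cmat \<Rightarrow> complex" where
  "canonical_trace C = (SOME T. is_canonical_trace C T)"

definition density_operator :: "'n::finite cmat set \<Rightarrow> ('n cmat \<Rightarrow> complex) \<Rightarrow> 'n cmat" where
  "density_operator C \<psi> = (THE Q. Q \<in> C \<and> psd Q \<and> (\<forall>x\<in>C. \<psi> x = canonical_trace C (Q ** x)))"

definition diag_mat :: "('n::finite \<Rightarrow> real) \<Rightarrow> 'n cmat" where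
  "diag_mat d = (\<chi> i j. if i = j then of_real (d i) else 0)"

text \<open>Functional calculus of a self-adjoint matrix, by unitary diagonalization.\<close>

definition fun_calc :: "(real \<Rightarrow> real) \<Rightarrow> 'n::finite cmat \<Rightarrow> 'n cmat" where
  "fun_calc f Q = (THE R. \<exists>u d. is_unitary u \<and> Q = u ** diag_mat d ** adj u
                              \<and> R = u ** diag_mat (f \<circ> d) ** adj u)"

definition eta :: "real \<Rightarrow> real" where
  "eta t = (if t = 0 then 0 else - t * ln t)"

text \<open>
  The logarithm of a positive operator is taken on its support and is \<open>0\<close> on its kernel.
  In the relative entropy below, for \<open>\<psi> \<le> c \<phi>\<close>, the kernel of \<open>Q\<^sub>\<phi>\<close> is contained in that of
  \<open>Q\<^sub>\<psi>\<close>, so that this amounts to the convention \<open>0 log 0 = 0\<close>. Without such a bound the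
  value is not meaningful.
\<close>

definition log0 :: "real \<Rightarrow> real" where
  "log0 t = (if t = 0 then 0 else ln t)"

definition vn_entropy :: "'n::finite cmat set \<Rightarrow> ('n cmat \<Rightarrow> complex) \<Rightarrow> real" where
  "vn_entropy C \<psi> = Re (canonical_trace C (fun_calc eta (density_operator C \<psi>)))"

definition rel_entropy ::
    "'n::finite cmat set \<Rightarrow> ('n cmat \<Rightarrow> complex) \<Rightarrow> ('n cmat \<Rightarrow> complex) \<Rightarrow> real" where
  "rel_entropy C \<psi> \<phi> = Re (canonical_trace C (density_operator C \<psi> **
     (fun_calc log0 (density_operator C \<psi>) - fun_calc log0 (density_operator C \<phi>))))"

definition normalized_trace :: "'n::finite cmat \<Rightarrow> complex" where
  "normalized_trace x = trace x / of_nat CARD('n)"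

definition is_cond_exp :: "'n::finite cmat set \<Rightarrow> ('n cmat \<Rightarrow> 'n cmat) \<Rightarrow> bool" where
  "is_cond_exp A E \<longleftrightarrow> (\<forall>x y. E (x + y) = E x + E y) \<and> (\<forall>c x. E (c *\<^sub>C x) = c *\<^sub>C E x)
     \<and> (\<forall>x. E x \<in> A) \<and> (\<forall>a\<in>A. E a = a)
     \<and> (\<forall>a\<in>A. \<forall>b\<in>A. \<forall>x. E (a ** x ** b) = a ** E x ** b)
     \<and> (\<forall>x. psd x \<longrightarrow> psd (E x))"

definition cond_exp :: "'n::finite cmat set \<Rightarrow> 'n cmat \<Rightarrow> 'n cmat" where
  "cond_exp A = (THE E. is_cond_exp A E \<and> (\<forall>x. normalized_trace (E x) = normalized_trace x))"

text \<open>Finite families are lists, since the same functional may occur more than once.\<close>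

definition decompositions :: "('n::finite cmat \<Rightarrow> complex) \<Rightarrow> ('n cmat \<Rightarrow> complex) list set" where
  "decompositions \<phi> = {\<Psi>. (\<forall>\<psi>\<in>set \<Psi>. positive_functional UNIV \<psi>)
                          \<and> (\<forall>x. (\<Sum>\<psi>\<leftarrow>\<Psi>. \<psi> x) = \<phi> x)}"

definition cond_rel_entropy ::
    "('n::finite cmat \<Rightarrow> complex) \<Rightarrow> 'n cmat set \<Rightarrow> 'n cmat set \<Rightarrow> ereal" where
  "cond_rel_entropy \<phi> A B = (SUP \<Psi>\<in>decompositions \<phi>.
     ereal (\<Sum>\<psi>\<leftarrow>\<Psi>. rel_entropy A \<psi> \<phi> - rel_entropy B (\<psi> \<circ> cond_exp A) (\<phi> \<circ> cond_exp A)))"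

definition matrix_units :: "('n::finite \<Rightarrow> 'n \<Rightarrow> 'n cmat) \<Rightarrow> bool" where
  "matrix_units E \<longleftrightarrow> (\<forall>i j k l. E i j ** E k l = (if j = k then E i l else 0))
     \<and> (\<forall>i j. adj (E i j) = E j i) \<and> (\<Sum>i\<in>UNIV. E i i) = mat 1"

definition matrix_wrt :: "('n::finite \<Rightarrow> 'n \<Rightarrow> 'n cmat) \<Rightarrow> 'n cmat \<Rightarrow> 'n cmat" where
  "matrix_wrt E x = (THE c. x = (\<Sum>k\<in>UNIV. \<Sum>l\<in>UNIV. (c $ k $ l) *\<^sub>C E k l))"

definition b_matrix :: "('n::finite \<Rightarrow> 'n \<Rightarrow> 'n cmat) \<Rightarrow> 'n cmat \<Rightarrow> real ^ 'n ^ 'n" where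
  "b_matrix E u = (\<chi> i j. (cmod (matrix_wrt E u $ i $ j))\<^sup>2)"

definition weighted_entropy :: "('n::finite \<Rightarrow> real) \<Rightarrow> real ^ 'n ^ 'n \<Rightarrow> real" where
  "weighted_entropy l b = (\<Sum>k\<in>UNIV. l k * (\<Sum>j\<in>UNIV. eta (b $ j $ k)))"

end

theory Submission
  imports Defs
begin

text \<open>
  In a unitary basis \<open>w\<close> adapted to the matrix units, \<open>D\<close> and \<open>uDu\<^sup>*\<close> are the algebras of matrices
  diagonal with respect to \<open>w\<close> and \<open>uw\<close>. A functional with diagonal \<open>q\<close> on \<open>D\<close> induces on \<open>uDu\<^sup>*\<close>,
  through the conditional expectation, the vector \<open>p\<^sub>j = \<Sum>\<^sub>k b\<^sub>k\<^sub>j q\<^sub>k\<close>. From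
  \<open>\<eta>(\<Sum>\<^sub>k b\<^sub>k\<^sub>j q\<^sub>k) \<le> \<Sum>\<^sub>k \<eta>(b\<^sub>k\<^sub>j q\<^sub>k)\<close>, \<open>\<eta>(ab) = a \<eta>(b) + b \<eta>(a)\<close> and the unit row sums of \<open>b\<close> one gets
  \<open>\<Sum>\<^sub>j \<eta>(p\<^sub>j) - \<Sum>\<^sub>k \<eta>(q\<^sub>k) \<le> \<Sum>\<^sub>k q\<^sub>k \<Sum>\<^sub>j \<eta>(b\<^sub>k\<^sub>j)\<close>, with equality when \<open>q\<close> has at most one nonzero entry.
  Hence each functional contributes at most a linear function of \<open>q\<close>, whose total does not depend
  on the decomposition, and the decomposition of \<open>\<phi>\<close> into the functionals
  \<open>x \<mapsto> \<lambda>\<^sub>i Tr(e\<^sub>i x)\<close> attains the bound.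
\<close>

section \<open>Matrices\<close>

lemma mult_nth: "(x ** y) $ i $ j = (\<Sum>k\<in>UNIV. x $ i $ k * y $ k $ j)"
  by (simp add: matrix_matrix_mult_def)

lemma cscale_nth [simp]: "(c *\<^sub>C x) $ i $ j = c * x $ i $ j"
  by (simp add: cscale_def)

lemma adj_nth [simp]: "adj x $ i $ j = cnj (x $ j $ i)"
  by (simp add: adj_def)

lemma adj_mult [simp]: "adj (x ** y) = adj y ** adj x"
  by (simp add: vec_eq_iff mult_nth mult.commute)

lemma adj_adj [simp]: "adj (adj x) = x"
  by (simp add: vec_eq_iff)

lemma cscale_mult_left [simp]: "(c *\<^sub>C x) ** y = c *\<^sub>C (x ** y)"
  by (simp add: vec_eq_iff mult_nth sum_distrib_left mult.assoc)

lemma cscale_mult_right [simp]: "x ** (c *\<^sub>C y) = c *\<^sub>C (x ** y)"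
  by (simp add: vec_eq_iff mult_nth sum_distrib_left mult.left_commute)

lemma cscale_zero [simp]: "0 *\<^sub>C x = 0"
  by (simp add: vec_eq_iff)

lemma matrix_mul_zero_left [simp]: "(0 :: 'n::finite cmat) ** x = 0"
  by (simp add: vec_eq_iff mult_nth)

lemma matrix_mul_zero_right [simp]: "x ** (0 :: 'n::finite cmat) = 0"
  by (simp add: vec_eq_iff mult_nth)

lemma trace_cscale: "trace (c *\<^sub>C x) = c * trace x"
  by (simp add: trace_def sum_distrib_left)

lemma matrix_add_rdistrib: "((x :: 'n::finite cmat) + y) ** z = x ** z + y ** z"
  by (simp add: vec_eq_iff mult_nth sum.distrib algebra_simps)

lemma matrix_mul_sum_left: "(\<Sum>i\<in>I. f i :: 'n::finite cmat) ** y = (\<Sum>i\<in>I. f i ** y)"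
  by (induction I rule: infinite_finite_induct) (auto simp: matrix_add_rdistrib)

lemma matrix_mul_sum_right: "(y :: 'n::finite cmat) ** (\<Sum>i\<in>I. f i) = (\<Sum>i\<in>I. y ** f i)"
  by (induction I rule: infinite_finite_induct) (auto simp: matrix_add_ldistrib)

lemma unitary_cancel:
  assumes "is_unitary w"
  shows "adj w ** w = mat 1" "w ** adj w = mat 1"
    "adj w ** (w ** x) = x" "w ** (adj w ** x) = x"
  using assms by (auto simp: is_unitary_def matrix_mul_assoc)

lemma is_unitary_mult: "is_unitary u \<Longrightarrow> is_unitary w \<Longrightarrow> is_unitary (u ** w)"
  by (simp add: is_unitary_def flip: matrix_mul_assoc) (simp add: matrix_mul_assoc)

lemma is_unitary_adj: "is_unitary u \<Longrightarrow> is_unitary (adj u)"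
  by (simp add: is_unitary_def)

text \<open>Read off a diagonal entry of \<open>z ** adj z = mat 1\<close>. This supplies the unit
  row sums of the matrix of squared moduli.\<close>

lemma unitary_row_sum:
  assumes "is_unitary z"
  shows "(\<Sum>j\<in>UNIV. (cmod (z $ i $ j))\<^sup>2) = 1"
proof -
  have "(z ** adj z) $ i $ i = 1"
    using assms by (simp add: is_unitary_def mat_def)
  then have "complex_of_real (\<Sum>j\<in>UNIV. (cmod (z $ i $ j))\<^sup>2) = of_real 1"
    by (simp add: mult_nth complex_norm_square del: of_real_power)
  then show ?thesis
    by (simp only: of_real_eq_iff)
qed

section \<open>Standard matrix units and the trace pairing\<close>

definition munit :: "'n \<Rightarrow> 'n \<Rightarrow> 'n::finite cmat" where
  "munit k l = (\<chi> i j. if i = k \<and> j = l then 1 else 0)"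

lemma munit_nth: "munit k l $ i $ j = (if i = k \<and> j = l then 1 else 0)"
  by (simp add: munit_def)

lemma munit_mult: "munit i j ** munit k l = (if j = k then munit i l else 0)"
  by (auto simp: vec_eq_iff mult_nth munit_nth if_distrib[of "\<lambda>x. _ * x"] sum.delta cong: if_cong)

lemma mult_munit_nth: "(x ** munit k l) $ i $ m = (if l = m then x $ i $ k else 0)"
  by (simp add: mult_nth munit_nth if_distrib[of "\<lambda>x. _ * x"] cong: if_cong)

lemma adj_munit [simp]: "adj (munit k l) = munit l k"
  by (auto simp: vec_eq_iff munit_nth)

lemma sum_delta_conj:
  fixes g :: "'n::finite \<Rightarrow> 'm::finite \<Rightarrow> complex"
  shows "(\<Sum>k\<in>UNIV. \<Sum>l\<in>UNIV. if i = k \<and> j = l then g k l else 0) = g i j"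
proof -
  have "(\<Sum>k\<in>UNIV. \<Sum>l\<in>UNIV. if i = k \<and> j = l then g k l else 0)
      = (\<Sum>k\<in>UNIV. if i = k then (\<Sum>l\<in>UNIV. if j = l then g k l else 0) else 0)"
    by (intro sum.cong) auto
  then show ?thesis
    by (simp add: sum.delta')
qed

lemma munit_expansion: "x = (\<Sum>k\<in>UNIV. \<Sum>l\<in>UNIV. (x $ k $ l) *\<^sub>C munit k l)"
  by (simp add: vec_eq_iff munit_nth if_distrib[of "\<lambda>x. _ * x"] sum_delta_conj cong: if_cong)

lemma trace_mult_munit: "trace (x ** munit j i) = x $ i $ j"
proof -
  have "trace (x ** munit j i) = (\<Sum>a\<in>UNIV. \<Sum>b\<in>UNIV. if i = a \<and> j = b then x $ a $ b else 0)"
    unfolding trace_def mult_nth munit_nth by (intro sum.cong) auto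
  then show ?thesis
    by (simp add: sum_delta_conj)
qed

text \<open>Pairing with matrix units recovers every entry, so the trace pairing is nondegenerate.
  Uniqueness of density operators rests on this.\<close>

lemma trace_mult_all_eq:
  assumes "\<And>x. trace (a ** x) = trace (b ** (x :: 'n::finite cmat))"
  shows "a = b"
  using assms[of "munit _ _"] by (simp add: trace_mult_munit vec_eq_iff)

section \<open>Positive semidefinite matrices\<close>

lemma sum_nonneg_Reals: "(\<And>i. i \<in> I \<Longrightarrow> f i \<in> \<real>\<^sub>\<ge>\<^sub>0) \<Longrightarrow> sum f I \<in> \<real>\<^sub>\<ge>\<^sub>0"
  by (induction I rule: infinite_finite_induct) auto

text \<open>The quadratic form at \<open>v\<close> is the trace against the rank-one matrix with
  entries \<open>v $ a * cnj (v $ b)\<close>; in this form cyclicity of the trace becomes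
  available.\<close>

lemma psd_trace: "psd x \<longleftrightarrow> (\<forall>v. trace (x ** (\<chi> a b. v $ a * cnj (v $ b))) \<in> \<real>\<^sub>\<ge>\<^sub>0)"
proof -
  have "(\<Sum>i\<in>UNIV. cnj (v $ i) * (x *v v) $ i) = trace (x ** (\<chi> a b. v $ a * cnj (v $ b)))" for v
    by (simp add: trace_def mult_nth matrix_vector_mult_def sum_distrib_left mult_ac)
  then show ?thesis
    by (simp add: psd_def)
qed

text \<open>Take \<open>y\<close> with the conjugate of \<open>v\<close> in one arbitrary row
  (indexed by \<open>undefined\<close>) and zeros elsewhere. A positive functional is thus
  nonnegative on every rank-one matrix that tests positivity.\<close>

lemma outer_product_gram: "\<exists>y. (\<chi> a b. v $ a * cnj (v $ b)) = adj y ** (y :: 'n::finite cmat)"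
proof
  define y :: "'n cmat" where "y = (\<chi> a b. if a = undefined then cnj (v $ b) else 0)"
  have *: "cnj (if k = undefined then cnj a else 0) * (if k = undefined then b else 0)
     = (if k = undefined then a * b else 0)" for k :: 'n and a b
    by simp
  show "(\<chi> a b. v $ a * cnj (v $ b)) = adj y ** y"
    unfolding y_def by (simp add: vec_eq_iff mult_nth * del: complex_cnj_cnj)
qed

text \<open>By cyclicity of the trace, testing at \<open>v\<close> amounts to testing
  \<open>x\<close> at \<open>y *v v\<close>.\<close>

lemma psd_mult_adj: "psd x \<Longrightarrow> psd (adj y ** x ** y)"
  unfolding psd_trace
proof
  fix v :: "(complex, 'a) vec"
  assume psd: "\<forall>v. trace (x ** (\<chi> a b. v $ a * cnj (v $ b))) \<in> \<real>\<^sub>\<ge>\<^sub>0"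
  have "y ** (\<chi> a b. v $ a * cnj (v $ b)) ** adj y = (\<chi> a b. (y *v v) $ a * cnj ((y *v v) $ b))"
    by (auto simp: vec_eq_iff mult_nth matrix_vector_mult_def sum_distrib_left sum_distrib_right
        mult_ac intro!: sum.swap)
  moreover have "trace (adj y ** x ** y ** (\<chi> a b. v $ a * cnj (v $ b)))
      = trace (x ** (y ** (\<chi> a b. v $ a * cnj (v $ b)) ** adj y))"
    using trace_mul_sym[of "adj y"] by (simp add: matrix_mul_assoc[symmetric])
  ultimately show "trace (adj y ** x ** y ** (\<chi> a b. v $ a * cnj (v $ b))) \<in> \<real>\<^sub>\<ge>\<^sub>0"
    using psd by simp
qed

lemma psd_diag_entry:
  assumes "psd x"
  shows "x $ i $ i \<in> \<real>\<^sub>\<ge>\<^sub>0"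
proof -
  have "(\<chi> a b. axis i 1 $ a * cnj (axis i 1 $ b)) = munit i i"
    by (auto simp: vec_eq_iff munit_nth axis_def)
  then show ?thesis
    using assms trace_mult_munit[of x i i] unfolding psd_trace by metis
qed

section \<open>Diagonalized matrices and maximal abelian subalgebras\<close>

text \<open>For unitary \<open>w\<close>, the matrix with eigenvalue \<open>d i\<close> on the i-th
  column of \<open>w\<close>. The eigenvalues are complex so that a whole algebra is covered, not
  only its self-adjoint part.\<close>

definition dg :: "'n::finite cmat \<Rightarrow> ('n \<Rightarrow> complex) \<Rightarrow> 'n cmat" where
  "dg w d = w ** (\<chi> i j. if i = j then d i else 0) ** adj w"

text \<open>For unitary \<open>w\<close>, \<open>dg w (ind i)\<close> is the rank-one projection
  onto the i-th column of \<open>w\<close>.\<close>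

abbreviation ind :: "'n \<Rightarrow> 'n \<Rightarrow> complex" where
  "ind i \<equiv> \<lambda>k. if k = i then 1 else 0"

text \<open>For unitary \<open>w\<close> this is a maximal abelian subalgebra. Both algebras of the
  theorem take this form, with \<open>w\<close> and \<open>u ** w\<close>.\<close>

definition masa :: "'n::finite cmat \<Rightarrow> 'n cmat set" where
  "masa w = range (dg w)"

lemma dg_in_masa [simp]: "dg w d \<in> masa w"
  by (simp add: masa_def)

lemma dg_add: "dg w c + dg w d = dg w (\<lambda>i. c i + d i)"
proof -
  have "(\<chi> i j. if i = j then c i + d i else 0) =
    (\<chi> i j. if i = j then c i else 0) + (\<chi> i j. if i = j then d i else 0)"
    by (simp add: vec_eq_iff)
  then show ?thesis
    by (simp add: dg_def matrix_add_ldistrib matrix_add_rdistrib)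
qed

lemma dg_cscale: "c *\<^sub>C dg w d = dg w (\<lambda>i. c * d i)"
proof -
  have "(\<chi> i j. if i = j then c * d i else 0) = c *\<^sub>C (\<chi> i j. if i = j then d i else 0)"
    by (simp add: vec_eq_iff)
  then show ?thesis
    by (simp add: dg_def)
qed

lemma dg_diff: "dg w c - dg w d = dg w (\<lambda>i. c i - d i)"
proof -
  have "dg w (\<lambda>i. c i - d i) + dg w d = dg w c"
    by (simp add: dg_add)
  then show ?thesis
    by (simp add: diff_eq_eq)
qed

lemma dg_zero [simp]: "dg w (\<lambda>_. 0) = 0"
  using dg_cscale[of 0 w "\<lambda>_. 0"] by simp

lemma dg_sum: "(\<Sum>i\<in>I. dg w (f i)) = dg w (\<lambda>k. \<Sum>i\<in>I. f i k)"
  by (induction I rule: infinite_finite_induct) (simp_all add: dg_add)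

lemma dg_expansion: "dg w d = (\<Sum>i\<in>UNIV. d i *\<^sub>C dg w (ind i))"
  by (simp add: dg_cscale dg_sum if_distrib[of "\<lambda>x. _ * x"] cong: if_cong)

lemma adj_dg: "adj (dg w d) = dg w (\<lambda>i. cnj (d i))"
proof -
  have "adj (\<chi> i j. if i = j then d i else 0) = (\<chi> i j. if i = j then cnj (d i) else 0)"
    by (simp add: vec_eq_iff)
  then show ?thesis
    by (simp add: dg_def matrix_mul_assoc)
qed

lemma dg_ind: "dg w (ind i) = w ** munit i i ** adj w"
proof -
  have "(\<chi> k l. if k = l then ind i k else 0) = munit i i"
    by (auto simp: vec_eq_iff munit_nth)
  then show ?thesis
    by (simp add: dg_def)
qed

lemma unitary_conj_dg: "u ** dg w d ** adj u = dg (u ** w) d"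
  by (simp add: dg_def matrix_mul_assoc)

lemma unitary_conj_masa: "unitary_conj u (masa w) = masa (u ** w)"
  by (auto simp: unitary_conj_def masa_def image_iff unitary_conj_dg)

context
  fixes w :: "'n::finite cmat"
  assumes w: "is_unitary w"
begin

lemma dg_mult: "dg w c ** dg w d = dg w (\<lambda>i. c i * d i)"
proof -
  have "(\<chi> i j. if i = j then c i else 0) ** (\<chi> i j. if i = j then d i else 0)
      = (\<chi> i j. if i = j then c i * d i else (0::complex))"
    by (simp add: vec_eq_iff mult_nth if_distrib[of "\<lambda>x. x * _"] cong: if_cong)
  then have "dg w (\<lambda>i. c i * d i)
      = w ** ((\<chi> i j. if i = j then c i else 0) ** (\<chi> i j. if i = j then d i else 0)) ** adj w"
    by (simp add: dg_def)
  then show ?thesis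
    by (simp add: dg_def unitary_cancel[OF w] flip: matrix_mul_assoc)
qed

lemma dg_one: "dg w (\<lambda>_. 1) = mat 1"
proof -
  have "(\<chi> i j. if i = j then 1 else 0) = (mat 1 :: 'n cmat)"
    by (simp add: vec_eq_iff mat_def)
  then show ?thesis
    by (simp add: dg_def unitary_cancel[OF w])
qed

lemma dg_inject: "dg w c = dg w d \<longleftrightarrow> c = d"
proof
  assume "dg w c = dg w d"
  then have "adj w ** dg w c ** w = adj w ** dg w d ** w"
    by simp
  then have "(\<chi> i j. if i = j then c i else 0) = (\<chi> i j. if i = j then d i else (0::complex))"
    by (simp add: dg_def unitary_cancel[OF w] flip: matrix_mul_assoc)
  then have "(\<chi> i j. if i = j then c i else 0) $ i $ i = (\<chi> i j. if i = j then d i else (0::complex)) $ i $ i" for i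
    by simp
  then show "c = d"
    by (simp add: fun_eq_iff)
qed simp

lemma dg_eq_zero: "dg w d = 0 \<longleftrightarrow> d = (\<lambda>_. 0)"
  using dg_inject[of d "\<lambda>_. 0"] by simp

lemma trace_dg_mult: "trace (dg w d ** x) = (\<Sum>i\<in>UNIV. d i * (adj w ** x ** w) $ i $ i)"
proof -
  have "trace (dg w d ** x) = trace ((\<chi> i j. if i = j then d i else 0) ** (adj w ** x ** w))"
    using trace_mul_sym[of w] by (simp add: dg_def flip: matrix_mul_assoc)
  also have "\<dots> = (\<Sum>i\<in>UNIV. d i * (adj w ** x ** w) $ i $ i)"
    by (simp add: trace_def mult_nth[of "\<chi> i j. _ i j"] if_distrib[of "\<lambda>x. x * _"] cong: if_cong)
  finally show ?thesis .
qed

lemma trace_dg: "trace (dg w d) = (\<Sum>i\<in>UNIV. d i)"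
  using trace_dg_mult[of d "mat 1"] by (simp add: unitary_cancel[OF w]) (simp add: mat_def)

lemma psd_dg:
  assumes "\<And>i. d i \<in> \<real>\<^sub>\<ge>\<^sub>0"
  shows "psd (dg w d)"
  unfolding psd_trace trace_dg_mult
proof
  fix v :: "(complex, 'n) vec"
  have "(adj w ** (\<chi> a b. v $ a * cnj (v $ b)) ** w) $ i $ i
      = (adj w *v v) $ i * cnj ((adj w *v v) $ i)" for i
    by (auto simp: mult_nth matrix_vector_mult_def sum_distrib_left sum_distrib_right mult_ac
       intro!: sum.swap)
  moreover have "z * cnj z \<in> \<real>\<^sub>\<ge>\<^sub>0" for z :: complex
    by (simp add: complex_nonneg_Reals_iff complex_mult_cnj)
  ultimately have "(adj w ** (\<chi> a b. v $ a * cnj (v $ b)) ** w) $ i $ i \<in> \<real>\<^sub>\<ge>\<^sub>0" for i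
    by metis
  then show "(\<Sum>i\<in>UNIV. d i * (adj w ** (\<chi> a b. v $ a * cnj (v $ b)) ** w) $ i $ i) \<in> \<real>\<^sub>\<ge>\<^sub>0"
    using assms by (intro sum_nonneg_Reals nonneg_Reals_mult_I)
qed

lemma star_subalgebra_masa: "star_subalgebra (masa w)"
  unfolding star_subalgebra_def masa_def
  by (auto simp: dg_add dg_mult dg_cscale adj_dg simp flip: dg_one)

text \<open>A subalgebra containing the rank-one projections contains their linear combinations, and
  these already form a subalgebra. It identifies the generated algebra \<open>D\<close>.\<close>

lemma masa_eq_hull: "star_subalgebra hull range (\<lambda>i. dg w (ind i)) = masa w"
proof (rule hull_unique)
  show "range (\<lambda>i. dg w (ind i)) \<subseteq> masa w"
    by auto
  fix C :: "'n cmat set"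
  assume gen: "range (\<lambda>i. dg w (ind i)) \<subseteq> C" and C: "star_subalgebra C"
  have zero: "0 \<in> C"
    using C cscale_zero[of "mat 1"] unfolding star_subalgebra_def by metis
  have "dg w d \<in> C" for d
  proof -
    have "(\<Sum>i\<in>I. d i *\<^sub>C dg w (ind i)) \<in> C" for I
    proof (induction I rule: infinite_finite_induct)
      case (insert i I)
      moreover have "d i *\<^sub>C dg w (ind i) \<in> C"
        using C gen unfolding star_subalgebra_def by blast
      ultimately show ?case
        using C unfolding star_subalgebra_def by simp
    qed (use zero in auto)
    then show ?thesis
      using dg_expansion[of w d] by simp
  qed
  then show "masa w \<subseteq> C"
    by (auto simp: masa_def)
qed (fact star_subalgebra_masa)

lemma is_projection_dg: "is_projection (dg w d) \<longleftrightarrow> (\<forall>i. d i = 0 \<or> d i = 1)"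
proof
  assume "is_projection (dg w d)"
  then have "(\<lambda>i. d i * d i) = d"
    by (simp add: is_projection_def dg_mult dg_inject)
  then show "\<forall>i. d i = 0 \<or> d i = 1"
    by (metis mult_cancel_right1)
next
  assume *: "\<forall>i. d i = 0 \<or> d i = 1"
  have "(\<lambda>i. d i * d i) = d" "(\<lambda>i. cnj (d i)) = d"
    using * by (auto intro!: ext dest: spec elim!: disjE) (metis complex_cnj_zero complex_cnj_one)+
  then show "is_projection (dg w d)"
    by (simp add: is_projection_def dg_mult adj_dg)
qed

text \<open>Projections correspond to vectors with entries 0 and 1. A nonzero one dominates the
  indicator of any index in its support, and nothing nonzero lies strictly below an
  indicator.\<close>

lemma minimal_projection_masa:
  "minimal_projection (masa w) p \<longleftrightarrow> (\<exists>i. p = dg w (ind i))"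
proof
  assume p: "minimal_projection (masa w) p"
  then obtain d where d: "p = dg w d"
    by (auto simp: minimal_projection_def masa_def)
  then obtain i where "d i = 1"
    using p by (auto simp: minimal_projection_def is_projection_dg dg_eq_zero fun_eq_iff)
  then have "(\<lambda>k. d k * ind i k) = ind i"
    by auto
  then have "p ** dg w (ind i) = dg w (ind i)"
    by (simp only: d dg_mult)
  moreover have "is_projection (dg w (ind i))" "dg w (ind i) \<noteq> 0"
    by (auto simp: is_projection_dg dg_eq_zero fun_eq_iff)
  ultimately show "\<exists>i. p = dg w (ind i)"
    using p dg_in_masa by (metis minimal_projection_def)
next
  assume "\<exists>i. p = dg w (ind i)"
  then obtain i where i: "p = dg w (ind i)" ..
  have "dg w d = 0 \<or> dg w d = p"
    if "is_projection (dg w d)" and "p ** dg w d = dg w d" for d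
  proof -
    have "(\<lambda>k. ind i k * d k) = d"
      using that(2) by (simp only: i dg_mult dg_inject)
    then have "d k = 0" if "k \<noteq> i" for k
      using that by (auto dest!: fun_cong[of _ _ k])
    moreover have "d i = 0 \<or> d i = 1"
      using that(1) by (simp add: is_projection_dg)
    ultimately have "d = (\<lambda>_. 0) \<or> d = ind i"
      unfolding fun_eq_iff by (cases "d i = 0") (metis, metis)
    then show ?thesis
      by (auto simp: i)
  qed
  then show "minimal_projection (masa w) p"
    by (auto simp: minimal_projection_def masa_def i is_projection_dg dg_eq_zero fun_eq_iff)
qed

end


lemma linear_functional_dg:
  assumes "linear_functional (masa w) f"
  shows "f (dg w d) = (\<Sum>i\<in>UNIV. d i * f (dg w (ind i)))"
proof -
  have zero: "f 0 = 0"
    using assms dg_in_masa[of w "\<lambda>_. 0"] unfolding linear_functional_def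
    by (metis cscale_zero mult_zero_left dg_zero)
  have "f (\<Sum>i\<in>I. d i *\<^sub>C dg w (ind i)) = (\<Sum>i\<in>I. d i * f (dg w (ind i)))" for I
  proof (induction I rule: infinite_finite_induct)
    case (insert i I)
    have "(\<Sum>i\<in>I. d i *\<^sub>C dg w (ind i)) \<in> masa w"
      by (simp add: dg_cscale dg_sum)
    moreover have "d i *\<^sub>C dg w (ind i) \<in> masa w"
      by (simp add: dg_cscale)
    ultimately show ?case
      using assms insert unfolding linear_functional_def by simp
  qed (simp_all add: zero)
  from this[of UNIV] show ?thesis
    by (subst dg_expansion[of w d])
qed

lemma linear_functional_subset:
  "linear_functional C f \<Longrightarrow> B \<subseteq> C \<Longrightarrow> linear_functional B f"
  unfolding linear_functional_def by blast

section \<open>Canonical traces of diagonal algebras and of the full matrix algebra\<close>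

lemma linear_functional_trace: "linear_functional C trace"
  by (simp add: linear_functional_def trace_add trace_cscale)

text \<open>The matrix trace shows that a canonical trace exists, so the choice operator yields one.
  Its values on the minimal projections then fix it on the algebra, whichever one is chosen.\<close>

lemma canonical_trace_masa:
  assumes w: "is_unitary w"
  shows "canonical_trace (masa w) (dg w d) = (\<Sum>i\<in>UNIV. d i)"
proof -
  have "is_canonical_trace (masa w) trace"
    unfolding is_canonical_trace_def
    by (auto simp: linear_functional_trace minimal_projection_masa[OF w] trace_dg[OF w]
        intro: trace_mul_sym)
  then have *: "is_canonical_trace (masa w) (canonical_trace (masa w))"
    unfolding canonical_trace_def by (metis someI_ex)
  then have "canonical_trace (masa w) (dg w (ind i)) = 1" for i
    unfolding is_canonical_trace_def minimal_projection_masa[OF w] by blast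
  then show ?thesis
    using * linear_functional_dg[of w "canonical_trace (masa w)" d]
    by (simp add: is_canonical_trace_def)
qed

text \<open>A nonzero column of \<open>p\<close> spans a line in the range of \<open>p\<close>. The
  projection \<open>q\<close> onto that line has trace one and lies below \<open>p\<close>, so
  minimality forces \<open>q = p\<close>.\<close>

lemma trace_minimal_projection:
  fixes p :: "'n::finite cmat"
  assumes p: "minimal_projection UNIV p"
  shows "trace p = 1"
proof -
  have pp: "p ** p = p" "p \<noteq> 0"
    using p by (auto simp: minimal_projection_def is_projection_def)
  then obtain a b where ab: "p $ a $ b \<noteq> 0"
    by (auto simp: vec_eq_iff)
  \<comment> \<open>\<open>N\<close> is the squared norm of column \<open>b\<close> of
    \<open>p\<close>, the normalization that makes \<open>q\<close> idempotent.\<close>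
  define N where "N = (\<Sum>i\<in>UNIV. p $ i $ b * cnj (p $ i $ b))"
  define q :: "'n cmat" where "q = (\<chi> i j. p $ i $ b * cnj (p $ j $ b) / N)"
  have N_eq: "N = of_real (\<Sum>i\<in>UNIV. (cmod (p $ i $ b))\<^sup>2)"
    by (simp add: N_def complex_norm_square del: of_real_power)
  have "(\<Sum>i\<in>UNIV. (cmod (p $ i $ b))\<^sup>2) \<noteq> 0"
    using ab by (subst sum_nonneg_eq_0_iff) auto
  then have N: "N \<noteq> 0"
    unfolding N_eq of_real_eq_0_iff .
  have cnjN: "cnj N = N"
    by (simp add: N_eq del: of_real_sum of_real_power)
  \<comment> \<open>Idempotence of \<open>p\<close> means that \<open>p\<close> fixes each of its
    own columns.\<close>
  have "(\<Sum>k\<in>UNIV. p $ i $ k * p $ k $ b) = p $ i $ b" for i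
    using pp by (metis mult_nth)
  then have pq: "p ** q = q"
    by (simp add: vec_eq_iff mult_nth q_def flip: mult.assoc sum_distrib_right sum_divide_distrib)
  have "q ** q = q"
  proof -
    have "(\<Sum>k\<in>UNIV. p $ i $ b * cnj (p $ k $ b) / N * (p $ k $ b * cnj (p $ j $ b) / N))
       = p $ i $ b * cnj (p $ j $ b) / N / N * N" for i j
      unfolding N_def[THEN arg_cong[of _ _ "\<lambda>x. _ * x"]] sum_distrib_left
      by (intro sum.cong) (simp_all add: mult_ac)
    then show ?thesis
      using N by (simp add: q_def vec_eq_iff mult_nth)
  qed
  moreover have "adj q = q"
    by (simp add: vec_eq_iff q_def cnjN mult.commute)
  ultimately have "is_projection q"
    by (simp add: is_projection_def)
  moreover have tr: "trace q = 1"
    using N by (simp add: trace_def q_def N_def flip: sum_divide_distrib)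
  then have "q \<noteq> 0"
    by (auto simp: trace_def)
  ultimately show ?thesis
    using p pq tr by (auto simp: minimal_projection_def)
qed

text \<open>A projection below \<open>munit i i\<close> equals its compression by it, hence is a
  scalar multiple of it; idempotence leaves only the scalars 0 and 1.\<close>

lemma minimal_projection_munit: "minimal_projection UNIV (munit i i)"
proof -
  have "q = 0 \<or> q = munit i i" if q: "is_projection q" "munit i i ** q = q" for q
  proof -
    have adj: "adj q = q"
      using q by (simp add: is_projection_def)
    then have "q ** munit i i = adj (munit i i ** q)"
      by simp
    then have "q ** munit i i = q"
      by (simp only: q(2) adj)
    then have "q = munit i i ** q ** munit i i"
      using q by simp
    also have "\<dots> = (q $ i $ i) *\<^sub>C munit i i"
    proof -
      have "(\<Sum>b\<in>UNIV. (\<Sum>a\<in>UNIV. (if k = i \<and> a = i then 1 else 0) * q $ a $ b)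
          * (if b = i \<and> l = i then 1 else 0)) = q $ i $ i * (if k = i \<and> l = i then 1 else 0)" for k l
        by (cases "k = i"; cases "l = i")
          (simp_all add: if_distrib[of "\<lambda>x. x * _"] if_distrib[of "\<lambda>x. _ * x"] cong: if_cong)
      then show ?thesis
        by (simp add: vec_eq_iff mult_nth munit_nth)
    qed
    finally have eq: "q = (q $ i $ i) *\<^sub>C munit i i" .
    then have "q $ i $ i *\<^sub>C munit i i = q $ i $ i *\<^sub>C (q $ i $ i *\<^sub>C munit i i)"
      using q(1) unfolding is_projection_def
      by (metis cscale_mult_left q(2))
    then have "(q $ i $ i *\<^sub>C munit i i) $ i $ i = (q $ i $ i *\<^sub>C (q $ i $ i *\<^sub>C munit i i)) $ i $ i"
      by simp
    then have "q $ i $ i = 0 \<or> q $ i $ i = 1"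
      by (simp add: munit_nth)
    moreover have "1 *\<^sub>C munit i i = munit i i"
      by (simp add: vec_eq_iff)
    ultimately show ?thesis
      using eq by (metis cscale_zero)
  qed
  moreover have "munit i i \<noteq> 0"
    by (auto simp: vec_eq_iff munit_nth)
  ultimately show ?thesis
    by (auto simp: minimal_projection_def is_projection_def munit_mult)
qed

lemma linear_functional_UNIV_sum:
  assumes "linear_functional UNIV f"
  shows "f (\<Sum>i\<in>I. c i *\<^sub>C x i) = (\<Sum>i\<in>I. c i * f (x i))"
proof -
  have "f 0 = 0"
    using assms unfolding linear_functional_def
    by (metis UNIV_I cscale_zero mult_zero_left)
  then show ?thesis
    using assms by (induction I rule: infinite_finite_induct) (auto simp: linear_functional_def)
qed

lemma linear_functional_UNIV_munit:
  assumes "linear_functional UNIV f"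
  shows "f x = (\<Sum>k\<in>UNIV. \<Sum>l\<in>UNIV. x $ k $ l * f (munit k l))"
proof -
  have one: "1 *\<^sub>C y = y" for y :: "'a cmat"
    by (simp add: vec_eq_iff)
  have "f x = f (\<Sum>k\<in>UNIV. 1 *\<^sub>C (\<Sum>l\<in>UNIV. (x $ k $ l) *\<^sub>C munit k l))"
    unfolding one by (subst munit_expansion[of x]) (rule refl)
  then show ?thesis
    by (simp only: linear_functional_UNIV_sum[OF assms] mult_1)
qed

lemma canonical_trace_UNIV: "canonical_trace UNIV = (trace :: 'n::finite cmat \<Rightarrow> complex)"
proof
  fix x :: "'n cmat"
  let ?T = "canonical_trace UNIV :: 'n cmat \<Rightarrow> complex"
  have "is_canonical_trace UNIV (trace :: 'n cmat \<Rightarrow> complex)"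
    unfolding is_canonical_trace_def
    by (auto simp: linear_functional_trace trace_minimal_projection intro: trace_mul_sym)
  then have T: "is_canonical_trace UNIV ?T"
    unfolding canonical_trace_def by (metis someI_ex)
  then have lin: "linear_functional UNIV ?T"
    by (simp add: is_canonical_trace_def)
  have "?T 0 = 0"
    using linear_functional_UNIV_sum[OF lin, of _ _ "{}"] by simp
  \<comment> \<open>Multiplying by \<open>munit l l\<close> on the right preserves
    \<open>munit k l\<close>, on the left annihilates it; the trace property equates the two
    values.\<close>
  have "?T (munit k l) = 0" if "k \<noteq> l" for k l
  proof -
    have "?T (munit k l ** munit l l) = ?T (munit l l ** munit k l)"
      using T by (simp add: is_canonical_trace_def)
    then show ?thesis
      using that \<open>?T 0 = 0\<close> by (simp add: munit_mult)
  qed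
  moreover have "?T (munit l l) = 1" for l
    using T minimal_projection_munit[of l] by (simp add: is_canonical_trace_def)
  ultimately have "?T (munit k l) = (if k = l then 1 else 0)" for k l
    by simp
  then show "?T x = trace x"
    by (subst linear_functional_UNIV_munit[OF lin])
      (simp add: trace_def if_distrib[of "\<lambda>x. _ * x"] cong: if_cong)
qed

section \<open>Densities, functional calculus and conditional expectations\<close>

text \<open>The values on matrix units prescribe the entries of the density operator. Its positivity
  is that of the functional on matrices \<open>adj y ** y\<close>, and nondegeneracy of the trace
  pairing gives uniqueness.\<close>

lemma density_operator_UNIV:
  assumes f: "positive_functional UNIV f"
  shows "f x = trace (density_operator UNIV f ** x)"
proof -
  define Q where "Q = (\<chi> i j. f (munit j i))"
  have lin: "linear_functional UNIV f"
    using f by (simp add: positive_functional_def)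
  have Q: "f x = trace (Q ** x)" for x
    by (subst linear_functional_UNIV_munit[OF lin], subst sum.swap)
      (simp add: trace_def mult_nth Q_def mult.commute)
  have "psd Q"
    unfolding psd_trace using f outer_product_gram
    by (metis Q UNIV_I positive_functional_def)
  then have "density_operator UNIV f = Q"
    unfolding density_operator_def canonical_trace_UNIV
    by (intro the_equality) (auto simp: Q intro: trace_mult_all_eq)
  then show ?thesis
    by (simp add: Q)
qed

lemma density_operator_masa:
  assumes w: "is_unitary w" and f: "linear_functional (masa w) f"
    and q: "\<And>i. f (dg w (ind i)) = of_real (q i)" "\<And>i. q i \<ge> 0"
  shows "density_operator (masa w) f = dg w (\<lambda>i. of_real (q i))"
  unfolding density_operator_def
proof (intro the_equality conjI ballI)
  show "psd (dg w (\<lambda>i. of_real (q i)))"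
    using q by (intro psd_dg[OF w]) simp
  fix x assume "x \<in> masa w"
  then obtain d where d: "x = dg w d"
    by (auto simp: masa_def)
  show "f x = canonical_trace (masa w) (dg w (\<lambda>i. of_real (q i)) ** x)"
    by (simp add: d dg_mult[OF w] canonical_trace_masa[OF w] linear_functional_dg[OF f, of d] q
        mult.commute)
next
  fix Q assume Q: "Q \<in> masa w \<and> psd Q \<and> (\<forall>x\<in>masa w. f x = canonical_trace (masa w) (Q ** x))"
  then obtain d where d: "Q = dg w d"
    by (auto simp: masa_def)
  have "f (dg w (ind i)) = d i" for i
    using Q by (simp add: d dg_mult[OF w] canonical_trace_masa[OF w] if_distrib[of "\<lambda>x. _ * x"] cong: if_cong)
  then show "Q = dg w (\<lambda>i. of_real (q i))"
    by (simp add: d flip: q)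
qed simp

text \<open>Equality of two diagonalized matrices is rewritten as an intertwining relation for the
  transition matrix \<open>adj w ** u\<close>, which can be checked entry by entry.\<close>

lemma dg_eq_iff:
  assumes u: "is_unitary u" and w: "is_unitary w"
  shows "dg u a = dg w b \<longleftrightarrow>
    (\<forall>i j. (adj w ** u) $ i $ j * a j = b i * (adj w ** u) $ i $ j)"
proof -
  have "dg u a = dg w b \<longleftrightarrow> adj w ** dg u a ** u = adj w ** dg w b ** u"
  proof
    assume "adj w ** dg u a ** u = adj w ** dg w b ** u"
    then have "w ** (adj w ** dg u a ** u) ** adj u = w ** (adj w ** dg w b ** u) ** adj u"
      by simp
    then show "dg u a = dg w b"
      by (simp add: unitary_cancel[OF u] unitary_cancel[OF w] flip: matrix_mul_assoc)
  qed simp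
  also have "\<dots> \<longleftrightarrow> (adj w ** u) ** (\<chi> i j. if i = j then a i else 0)
      = (\<chi> i j. if i = j then b i else 0) ** (adj w ** u)"
    by (simp add: dg_def unitary_cancel[OF u] unitary_cancel[OF w] flip: matrix_mul_assoc)
  also have "\<dots> \<longleftrightarrow> (\<forall>i j. (adj w ** u) $ i $ j * a j = b i * (adj w ** u) $ i $ j)"
    by (simp add: vec_eq_iff mult_nth[of "adj w ** u"] mult_nth[of _ "adj w ** u"]
        if_distrib[of "\<lambda>x. _ * x"] if_distrib[of "\<lambda>x. x * _"] cong: if_cong)
  finally show ?thesis .
qed

text \<open>The value must not depend on the diagonalization chosen, since the functional calculus
  is a definite description.\<close>

lemma fun_calc_dg:
  assumes w: "is_unitary w"
  shows "fun_calc f (dg w (\<lambda>i. of_real (d i))) = dg w (\<lambda>i. of_real (f (d i)))"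
proof -
  have diag: "u ** diag_mat a ** adj u = dg u (\<lambda>i. of_real (a i))" for u :: "'a cmat" and a
    by (simp add: dg_def diag_mat_def)
  show ?thesis
    unfolding fun_calc_def diag comp_def
  proof (intro the_equality, goal_cases)
    case (2 R)
    then obtain u a where u: "is_unitary u"
      and eq: "dg u (\<lambda>i. of_real (a i)) = dg w (\<lambda>i. of_real (d i))"
      and R: "R = dg u (\<lambda>i. of_real (f (a i)))"
      by metis
    \<comment> \<open>Wherever the transition matrix is nonzero the two eigenvalues agree, hence so
      do their images under \<open>f\<close>; that is the intertwining relation for the
      images.\<close>
    have "(adj w ** u) $ i $ j = 0 \<or> a j = d i" for i j
      using eq unfolding dg_eq_iff[OF u w]
      by (metis mult.commute mult_right_cancel of_real_eq_iff)
    then show ?case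
      unfolding R dg_eq_iff[OF u w] by (metis mult.commute mult_zero_left)
  qed (use w in blast)
qed

lemma vn_entropy_masa:
  assumes "is_unitary w" "linear_functional (masa w) f"
    and "\<And>i. f (dg w (ind i)) = of_real (q i)" "\<And>i. q i \<ge> 0"
  shows "vn_entropy (masa w) f = (\<Sum>i\<in>UNIV. eta (q i))"
  using assms by (simp add: vn_entropy_def density_operator_masa fun_calc_dg canonical_trace_masa)

lemma rel_entropy_masa:
  assumes "is_unitary w" "linear_functional (masa w) f" "linear_functional (masa w) g"
    and "\<And>i. f (dg w (ind i)) = of_real (q i)" "\<And>i. q i \<ge> 0"
    and "\<And>i. g (dg w (ind i)) = of_real (p i)" "\<And>i. p i \<ge> 0"
  shows "rel_entropy (masa w) f g = (\<Sum>i\<in>UNIV. q i * (log0 (q i) - log0 (p i)))"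
  using assms
  by (simp add: rel_entropy_def density_operator_masa[of w f q] density_operator_masa[of w g p]
      fun_calc_dg canonical_trace_masa dg_diff dg_mult)

text \<open>The expectation keeps the diagonal in the basis \<open>w\<close>. This map has all
  required properties, and the bimodule law together with trace preservation leaves no
  other.\<close>

lemma cond_exp_masa:
  fixes w :: "'n::finite cmat"
  assumes w: "is_unitary w"
  shows "cond_exp (masa w) x = dg w (\<lambda>i. (adj w ** x ** w) $ i $ i)"
proof -
  let ?F = "\<lambda>x. dg w (\<lambda>i. (adj w ** x ** w) $ i $ i)"
  have dd: "adj w ** (dg w d ** x ** dg w d') ** w
      = (\<chi> i j. if i = j then d i else 0) ** (adj w ** x ** w) ** (\<chi> i j. if i = j then d' i else 0)"
    for d d' x
    by (simp add: dg_def unitary_cancel[OF w] flip: matrix_mul_assoc)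
  have bimodule: "?F (dg w d ** x ** dg w d') = dg w d ** ?F x ** dg w d'" for d d' x
    unfolding dd dg_mult[OF w]
    by (simp add: mult_nth[of _ "\<chi> i j. _ i j"] mult_nth[of "\<chi> i j. _ i j"]
        if_distrib[of "\<lambda>x. _ * x"] if_distrib[of "\<lambda>x. x * _"] cong: if_cong)
  have on_masa: "?F (dg w d) = dg w d" for d
  proof -
    have "adj w ** dg w d ** w = (\<chi> i j. if i = j then d i else 0)"
      by (simp add: dg_def unitary_cancel[OF w] flip: matrix_mul_assoc)
    then show ?thesis
      by simp
  qed
  have "is_cond_exp (masa w) ?F"
    unfolding is_cond_exp_def
  proof (intro conjI allI ballI impI)
    fix x y show "?F (x + y) = ?F x + ?F y"
      by (simp add: dg_add matrix_add_ldistrib matrix_add_rdistrib)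
  next
    fix a b x assume "a \<in> masa w" "b \<in> masa w"
    then show "?F (a ** x ** b) = a ** ?F x ** b"
      using bimodule by (auto simp: masa_def)
  next
    fix x :: "'n cmat" assume "psd x"
    then show "psd (?F x)"
      by (intro psd_dg[OF w] psd_diag_entry psd_mult_adj)
  qed (use on_masa in \<open>auto simp: masa_def dg_cscale\<close>)
  moreover have "normalized_trace (?F x) = normalized_trace x" for x
    using trace_dg_mult[OF w, of "\<lambda>_. 1" x]
    by (simp add: normalized_trace_def trace_dg[OF w] dg_one[OF w])
  moreover have "F = ?F"
    if F: "is_cond_exp (masa w) F" and tr: "\<And>x. normalized_trace (F x) = normalized_trace x" for F
  proof
    fix x
    have "F x \<in> masa w"
      using F by (simp add: is_cond_exp_def)
    then obtain d where d: "F x = dg w d"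
      by (auto simp: masa_def)
    have "d i = (adj w ** x ** w) $ i $ i" for i
    proof -
      \<comment> \<open>The right factor is the identity, inserted to match the two-sided bimodule
        law. Taking traces afterwards isolates \<open>d i\<close>.\<close>
      have "F (dg w (ind i) ** x ** dg w (\<lambda>_. 1)) = dg w (ind i) ** F x ** dg w (\<lambda>_. 1)"
        using F unfolding is_cond_exp_def by (meson dg_in_masa)
      then have "F (dg w (ind i) ** x) = dg w (ind i) ** F x"
        by (simp add: dg_one[OF w])
      then have "trace (dg w (ind i) ** F x) = trace (dg w (ind i) ** x)"
        using tr[of "dg w (ind i) ** x"] by (simp add: normalized_trace_def)
      moreover have "trace (dg w (ind i) ** F x) = d i"
        by (simp add: d dg_mult[OF w] trace_dg[OF w] if_distrib[of "\<lambda>x. x * _"] cong: if_cong)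
      ultimately show ?thesis
        by (simp add: trace_dg_mult[OF w] if_distrib[of "\<lambda>x. x * _"] cong: if_cong)
    qed
    then have "d = (\<lambda>i. (adj w ** x ** w) $ i $ i)"
      by (rule ext)
    then show "F x = ?F x"
      by (simp only: d)
  qed
  ultimately have "cond_exp (masa w) = ?F"
    unfolding cond_exp_def by (intro the_equality) blast+
  then show ?thesis
    by simp
qed


section \<open>Matrix units\<close>

text \<open>Any system of matrix units is unitarily equivalent to the standard one: carry one unit
  vector in the range of \<open>E o' o'\<close> around by the \<open>E k o'\<close> to obtain an
  orthonormal basis.\<close>

lemma matrix_units_unitary:
  fixes E :: "'n::finite \<Rightarrow> 'n \<Rightarrow> 'n cmat"
  assumes "matrix_units E"
  obtains w where "is_unitary w" "\<And>k l. E k l = w ** munit k l ** adj w"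
proof -
  have mult: "E i j ** E k l = (if j = k then E i l else 0)"
    and adj: "adj (E i j) = E j i" and one: "(\<Sum>i\<in>UNIV. E i i) = mat 1" for i j k l
    using assms by (auto simp: matrix_units_def)
  define o' :: 'n where "o' = undefined"
  \<comment> \<open>If one diagonal unit vanished, all would, contradicting that they sum to the
    identity.\<close>
  have "E o' o' \<noteq> 0"
  proof
    assume "E o' o' = 0"
    then have "E i i = 0" for i
      using mult[of i o' o' o'] mult[of i o' o' i] by simp
    then have "(mat 1 :: 'n cmat) $ undefined $ undefined = 0"
      by (simp flip: one)
    then show False
      by (simp add: mat_def)
  qed
  then obtain a b where ab: "E o' o' $ a $ b \<noteq> 0"
    by (auto simp: vec_eq_iff)
  define N where "N = (\<Sum>i\<in>UNIV. (cmod (E o' o' $ i $ b))\<^sup>2)"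
  have "N \<noteq> 0" "N \<ge> 0"
    using ab unfolding N_def by (subst sum_nonneg_eq_0_iff) (auto intro: sum_nonneg)
  define c where "c = complex_of_real (1 / sqrt N)"
  have c: "c * cnj c * of_real N = 1"
    using \<open>N \<noteq> 0\<close> \<open>N \<ge> 0\<close> by (simp add: c_def flip: of_real_mult)
  \<comment> \<open>Column \<open>k\<close> of \<open>w\<close> is \<open>E k o'\<close> applied to
    basis vector \<open>b\<close>, which \<open>E o' o'\<close> does not annihilate;
    \<open>c\<close> normalizes its length.\<close>
  define w :: "'n cmat" where "w = (\<chi> i k. c * E k o' $ i $ b)"
  have "adj w ** w = mat 1"
  proof -
    have "(adj w ** w) $ k $ l = mat 1 $ k $ l" for k l
    proof -
      have "(adj w ** w) $ k $ l = cnj c * c * (E o' k ** E l o') $ b $ b"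
        by (simp add: mult_nth w_def sum_distrib_left mult_ac flip: adj[of k o'])
      also have "\<dots> = (if k = l then cnj c * c * (E o' o' ** E o' o') $ b $ b else 0)"
        by (simp add: mult)
      \<comment> \<open>Since \<open>E o' o'\<close> is self-adjoint, this entry is the squared norm
        \<open>N\<close> of its column \<open>b\<close>.\<close>
      also have "(E o' o' ** E o' o') $ b $ b = (adj (E o' o') ** E o' o') $ b $ b"
        by (simp only: adj)
      also have "\<dots> = of_real N"
        by (simp add: mult_nth N_def complex_norm_square mult.commute del: of_real_power)
      finally show ?thesis
        using c by (simp add: mat_def mult.commute)
    qed
    then show ?thesis
      by (simp add: vec_eq_iff)
  qed
  then have w: "is_unitary w"
    by (simp add: is_unitary_def matrix_left_right_inverse)
  have "E k l ** w = w ** munit k l" for k l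
  proof -
    have "(E k l ** w) $ i $ m = c * (E k l ** E m o') $ i $ b" for i m
      by (simp add: mult_nth w_def sum_distrib_left mult_ac)
    then show ?thesis
      by (simp add: vec_eq_iff mult mult_munit_nth w_def)
  qed
  then have "E k l = w ** munit k l ** adj w" for k l
    by (metis unitary_cancel(2)[OF w] matrix_mul_assoc matrix_mul_rid)
  with w that show thesis
    by blast
qed

lemma matrix_wrt_unitary:
  fixes w :: "'n::finite cmat"
  assumes w: "is_unitary w" and E: "\<And>k l. E k l = w ** munit k l ** adj w"
  shows "matrix_wrt E x = adj w ** x ** w"
proof -
  have "(\<Sum>k\<in>UNIV. \<Sum>l\<in>UNIV. (c $ k $ l) *\<^sub>C E k l) = w ** c ** adj w" for c
  proof -
    have "w ** (\<Sum>k\<in>UNIV. \<Sum>l\<in>UNIV. (c $ k $ l) *\<^sub>C munit k l) ** adj w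
      = (\<Sum>k\<in>UNIV. \<Sum>l\<in>UNIV. (c $ k $ l) *\<^sub>C E k l)"
      by (simp add: matrix_mul_sum_left matrix_mul_sum_right E)
    then show ?thesis
      by (simp flip: munit_expansion)
  qed
  then show ?thesis
    unfolding matrix_wrt_def
    by (intro the_equality)
      (simp_all add: unitary_cancel[OF w] flip: matrix_mul_assoc)
qed

text \<open>The diagonal in one basis of a rank-one projection from another consists of squared
  moduli of transition entries. This is where the bistochastic matrix arises.\<close>

lemma cond_exp_masa_dg_ind:
  assumes w: "is_unitary w"
  shows "cond_exp (masa w) (dg v (ind j)) = dg w (\<lambda>k. of_real ((cmod ((adj w ** v) $ k $ j))\<^sup>2))"
proof -
  have "(z ** munit j j ** adj z) $ k $ k = of_real ((cmod (z $ k $ j))\<^sup>2)" for z :: "'a cmat" and k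
    by (simp add: mult_nth[of _ "adj z"] mult_munit_nth complex_norm_square if_distrib[of "\<lambda>x. x * _"]
        cong: if_cong del: of_real_power)
  from this[of "adj w ** v"] show ?thesis
    by (simp add: cond_exp_masa[OF w] dg_ind matrix_mul_assoc del: of_real_power)
qed

lemma linear_functional_cond_exp:
  assumes "is_unitary w" "linear_functional UNIV f"
  shows "linear_functional UNIV (f \<circ> cond_exp (masa w))"
  using assms
  by (simp add: linear_functional_def cond_exp_masa matrix_add_ldistrib matrix_add_rdistrib
      flip: dg_add dg_cscale)

lemma positive_functional_dg_ind:
  assumes w: "is_unitary w" and f: "positive_functional UNIV f"
  shows "f (dg w (ind i)) = of_real (Re (f (dg w (ind i))))" "Re (f (dg w (ind i))) \<ge> 0"
proof -
  have "adj (dg w (ind i)) ** dg w (ind i) = dg w (ind i)"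
    by (simp add: adj_dg dg_mult[OF w] if_distrib[of "\<lambda>x. _ * x"] if_distrib[of cnj] cong: if_cong)
  then have "f (dg w (ind i)) \<in> \<real>\<^sub>\<ge>\<^sub>0"
    using f unfolding positive_functional_def by (metis UNIV_I)
  then show "f (dg w (ind i)) = of_real (Re (f (dg w (ind i))))" "Re (f (dg w (ind i))) \<ge> 0"
    by (auto simp: complex_nonneg_Reals_iff complex_eq_iff)
qed

text \<open>The trace of \<open>dg w (ind i)\<close> against \<open>adj x ** x\<close> is the i-th
  diagonal entry of the Gram matrix of \<open>x ** w\<close>. These functionals form the optimal
  decomposition.\<close>

lemma positive_functional_trace_dg:
  assumes w: "is_unitary w" and r: "r \<ge> 0"
  shows "positive_functional UNIV (\<lambda>x. of_real r * trace (dg w (ind i) ** x))"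
proof -
  have "trace (dg w (ind i) ** (adj x ** x)) \<in> \<real>\<^sub>\<ge>\<^sub>0" for x
  proof -
    have "psd (mat 1 :: 'a cmat)"
      using psd_dg[OF w, of "\<lambda>_. 1"] by (simp add: dg_one[OF w])
    then have "(adj (x ** w) ** mat 1 ** (x ** w)) $ i $ i \<in> \<real>\<^sub>\<ge>\<^sub>0"
      by (intro psd_diag_entry psd_mult_adj)
    then show ?thesis
      unfolding trace_dg_mult[OF w] by (simp add: matrix_mul_assoc if_distrib[of "\<lambda>x. x * _"] cong: if_cong)
  qed
  then show ?thesis
    using r unfolding positive_functional_def linear_functional_def
    by (simp add: matrix_add_ldistrib trace_add trace_cscale algebra_simps)
qed

section \<open>Entropy inequalities\<close>

lemma eta_log0: "eta t = - t * log0 t"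
  by (simp add: eta_def log0_def)

lemma eta_mult:
  assumes "a \<ge> 0" "b \<ge> 0"
  shows "eta (a * b) = a * eta b + b * eta a"
  using assms by (auto simp: eta_def ln_mult algebra_simps)

text \<open>Each nonzero term is at most the whole sum, so monotonicity of the logarithm bounds it
  termwise; zero terms contribute nothing.\<close>

lemma eta_sum_le:
  assumes "finite I" "\<And>i. i \<in> I \<Longrightarrow> a i \<ge> 0"
  shows "eta (sum a I) \<le> (\<Sum>i\<in>I. eta (a i))"
proof -
  have "a i * log0 (a i) \<le> a i * log0 (sum a I)" if "i \<in> I" for i
  proof (cases "a i = 0")
    case False
    then have "0 < a i" "a i \<le> sum a I"
      using assms that by (auto simp: less_le intro: member_le_sum)
    then show ?thesis
      by (simp add: log0_def)
  qed simp
  then show ?thesis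
    by (simp add: eta_log0 sum_distrib_right sum_negf sum_mono)
qed

text \<open>Bounds the entropy gained by mixing \<open>q\<close> through the stochastic matrix
  \<open>b\<close>: apply subadditivity to each \<open>j\<close>, then the product rule, and sum out
  \<open>b\<close> by its rows.\<close>

lemma eta_mixture_le:
  fixes q :: "'n::finite \<Rightarrow> real" and b :: "'n \<Rightarrow> 'm::finite \<Rightarrow> real"
  assumes q: "\<And>k. q k \<ge> 0" and b: "\<And>k j. b k j \<ge> 0" and row: "\<And>k. (\<Sum>j\<in>UNIV. b k j) = 1"
  shows "(\<Sum>j\<in>UNIV. eta (\<Sum>k\<in>UNIV. b k j * q k))
    \<le> (\<Sum>k\<in>UNIV. eta (q k)) + (\<Sum>k\<in>UNIV. q k * (\<Sum>j\<in>UNIV. eta (b k j)))"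
proof -
  have "(\<Sum>j\<in>UNIV. eta (\<Sum>k\<in>UNIV. b k j * q k)) \<le> (\<Sum>j\<in>UNIV. \<Sum>k\<in>UNIV. eta (b k j * q k))"
    using q b by (intro sum_mono eta_sum_le) auto
  also have "\<dots> = (\<Sum>k\<in>UNIV. \<Sum>j\<in>UNIV. b k j * eta (q k) + q k * eta (b k j))"
    using q b by (subst sum.swap) (simp add: eta_mult)
  also have "\<dots> = (\<Sum>k\<in>UNIV. eta (q k)) + (\<Sum>k\<in>UNIV. q k * (\<Sum>j\<in>UNIV. eta (b k j)))"
    by (simp add: sum.distrib row flip: sum_distrib_left sum_distrib_right)
  finally show ?thesis .
qed

text \<open>Each inner sum has a single possibly nonzero term, so subadditivity loses
  nothing.\<close>

lemma eta_mixture_eq_point: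
  fixes i :: "'n::finite" and b :: "'n \<Rightarrow> 'm::finite \<Rightarrow> real"
  assumes r: "r \<ge> 0" and b: "\<And>k j. b k j \<ge> 0" and row: "\<And>k. (\<Sum>j\<in>UNIV. b k j) = 1"
  defines "q \<equiv> \<lambda>k. if k = i then r else 0"
  shows "(\<Sum>j\<in>UNIV. eta (\<Sum>k\<in>UNIV. b k j * q k))
    = (\<Sum>k\<in>UNIV. eta (q k)) + (\<Sum>k\<in>UNIV. q k * (\<Sum>j\<in>UNIV. eta (b k j)))"
proof -
  have "eta 0 = 0"
    by (simp add: eta_def)
  then have "(\<Sum>k\<in>UNIV. eta (q k)) + (\<Sum>k\<in>UNIV. q k * (\<Sum>j\<in>UNIV. eta (b k j)))
      = eta r + r * (\<Sum>j\<in>UNIV. eta (b i j))"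
    by (simp add: q_def if_distrib[of eta] if_distrib[of "\<lambda>x. x * _"] cong: if_cong)
  moreover have "(\<Sum>j\<in>UNIV. eta (\<Sum>k\<in>UNIV. b k j * q k)) = (\<Sum>j\<in>UNIV. b i j * eta r + r * eta (b i j))"
    using r b by (simp add: q_def if_distrib[of "\<lambda>x. _ * x"] eta_mult cong: if_cong)
  ultimately show ?thesis
    by (simp add: sum.distrib row flip: sum_distrib_left sum_distrib_right)
qed

lemma sum_list_sum_swap:
  fixes f :: "'a \<Rightarrow> 'b \<Rightarrow> 'c::comm_monoid_add"
  shows "(\<Sum>x\<leftarrow>xs. \<Sum>k\<in>I. f x k) = (\<Sum>k\<in>I. \<Sum>x\<leftarrow>xs. f x k)"
  by (induction xs) (simp_all add: sum.distrib)

theorem theorem2: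
  fixes \<phi> :: "'n::{finite,linorder} cmat \<Rightarrow> complex"
    and l :: "'n \<Rightarrow> real"
    and e :: "'n \<Rightarrow> 'n cmat"
    and E :: "'n \<Rightarrow> 'n \<Rightarrow> 'n cmat"
    and u :: "'n cmat"
    and D :: "'n cmat set"
  assumes "is_state \<phi>"
    and "antimono l"
    and "\<And>i. minimal_projection UNIV (e i)"
    and "\<And>i j. i \<noteq> j \<Longrightarrow> e i ** e j = 0"
    and "density_operator UNIV \<phi> = (\<Sum>i\<in>UNIV. of_real (l i) *\<^sub>C e i)"
    and "matrix_units E"
    and "\<And>i. E i i = e i"
    and "D = star_subalgebra hull range e"
    and "is_unitary u"
  shows "cond_rel_entropy \<phi> D (unitary_conj u D) =
    ereal (weighted_entropy l (transpose (b_matrix E u))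
           + vn_entropy D \<phi> - vn_entropy (unitary_conj u D) \<phi>)"
proof -

  \<comment> \<open>The adapted basis and the bistochastic matrix\<close>
  obtain w where w: "is_unitary w" and E: "\<And>k l. E k l = w ** munit k l ** adj w"
    using matrix_units_unitary[OF assms(6)] by blast
  have e: "e i = dg w (ind i)" for i
    using E[of i i] assms(7)[of i] by (simp add: dg_ind)
  have D: "D = masa w"
    using assms(8) masa_eq_hull[OF w] e by simp
  define v where "v = u ** w"
  have v: "is_unitary v"
    unfolding v_def by (intro is_unitary_mult assms w)
  have uD: "unitary_conj u D = masa v"
    by (simp add: D v_def unitary_conj_masa)
  \<comment> \<open>\<open>z\<close> is both the transition matrix between the two bases and, as
    \<open>v = u ** w\<close>, the matrix of \<open>u\<close> in the given matrix units.\<close>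
  define z where "z = adj w ** v"
  define b where "b k j = (cmod (z $ k $ j))\<^sup>2" for k j
  have b_matrix: "b_matrix E u $ k $ j = b k j" for k j
    by (simp add: b_matrix_def matrix_wrt_unitary[OF w E] b_def z_def v_def matrix_mul_assoc)
  have b_nonneg: "b k j \<ge> 0" for k j
    by (simp add: b_def)
  have "is_unitary z"
    unfolding z_def by (intro is_unitary_mult is_unitary_adj w v)
  then have b_row: "(\<Sum>j\<in>UNIV. b k j) = 1" for k
    unfolding b_def by (rule unitary_row_sum)

  \<comment> \<open>Diagonals of functionals on the two algebras\<close>
  have pos: "positive_functional UNIV \<phi>"
    using assms(1) by (simp add: is_state_def)
  have \<phi>: "\<phi> x = trace (dg w (\<lambda>i. of_real (l i)) ** x)" for x
    using density_operator_UNIV[OF pos, of x] by (simp add: assms(5) e flip: dg_expansion)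
  have \<phi>_w: "\<phi> (dg w (ind i)) = of_real (l i)" for i
    by (simp add: \<phi> dg_mult[OF w] trace_dg[OF w] if_distrib[of "\<lambda>x. _ * x"] cong: if_cong)
  have l_nonneg: "l i \<ge> 0" for i
    using positive_functional_dg_ind(2)[OF w pos, of i] by (simp add: \<phi>_w)
  define P where "P j = (\<Sum>k\<in>UNIV. b k j * l k)" for j
  have P_nonneg: "P j \<ge> 0" for j
    unfolding P_def by (intro sum_nonneg mult_nonneg_nonneg b_nonneg l_nonneg)
  have lin: "linear_functional C \<psi>" if "positive_functional UNIV \<psi>" for \<psi> and C :: "'n cmat set"
    using that linear_functional_subset[of UNIV \<psi> C] by (simp add: positive_functional_def)
  have lin_E: "linear_functional C (\<psi> \<circ> cond_exp (masa w))" if "positive_functional UNIV \<psi>"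
    for \<psi> and C :: "'n cmat set"
    using linear_functional_subset[OF linear_functional_cond_exp[OF w lin[OF that]]] by blast

  define q where "q \<psi> k = Re (\<psi> (dg w (ind k)))" for \<psi> :: "'n cmat \<Rightarrow> complex" and k
  have q: "\<psi> (dg w (ind k)) = of_real (q \<psi> k)" "q \<psi> k \<ge> 0" if "positive_functional UNIV \<psi>" for \<psi> k
    using positive_functional_dg_ind[OF w that] by (simp_all add: q_def)
  define p where "p \<psi> j = (\<Sum>k\<in>UNIV. b k j * q \<psi> k)" for \<psi> :: "'n cmat \<Rightarrow> complex" and j
  have p: "(\<psi> \<circ> cond_exp (masa w)) (dg v (ind j)) = of_real (p \<psi> j)" "p \<psi> j \<ge> 0"
    if "positive_functional UNIV \<psi>" for \<psi> j
  proof -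
    have "(\<psi> \<circ> cond_exp (masa w)) (dg v (ind j)) = \<psi> (dg w (\<lambda>k. of_real (b k j)))"
      by (simp only: comp_apply cond_exp_masa_dg_ind[OF w] b_def z_def)
    then show "(\<psi> \<circ> cond_exp (masa w)) (dg v (ind j)) = of_real (p \<psi> j)"
      by (simp add: linear_functional_dg[OF lin[OF that], of w "\<lambda>k. of_real (b k j)"] q(1)[OF that] p_def)
    show "p \<psi> j \<ge> 0"
      unfolding p_def by (intro sum_nonneg mult_nonneg_nonneg b_nonneg q that)
  qed
  have q\<phi>: "q \<phi> = l"
    by (simp add: q_def \<phi>_w fun_eq_iff)
  have p\<phi>: "p \<phi> = P"
    by (simp add: p_def q\<phi> P_def fun_eq_iff)
  \<comment> \<open>The density of \<phi> is diagonal in the basis \<open>w\<close>, so the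
    expectation leaves \<phi> invariant. Hence \<open>P\<close> describes both the reference
    functional of the second relative entropy and \<phi> itself on the rotated algebra.\<close>
  have \<phi>_E: "\<phi> \<circ> cond_exp (masa w) = \<phi>"
    by (simp add: fun_eq_iff \<phi> cond_exp_masa[OF w] dg_mult[OF w] trace_dg[OF w] trace_dg_mult[OF w])
  have S_D: "vn_entropy D \<phi> = (\<Sum>k\<in>UNIV. eta (l k))"
    unfolding D by (rule vn_entropy_masa[OF w lin[OF pos] \<phi>_w l_nonneg])
  have S_uD: "vn_entropy (unitary_conj u D) \<phi> = (\<Sum>j\<in>UNIV. eta (P j))"
    unfolding uD using p(1)[OF pos] P_nonneg
    by (intro vn_entropy_masa[OF v lin[OF pos]]) (simp_all add: \<phi>_E p\<phi>)

  \<comment> \<open>The linear upper bound on each summand\<close>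
  define t where "t \<psi> = rel_entropy D \<psi> \<phi>
      - rel_entropy (unitary_conj u D) (\<psi> \<circ> cond_exp D) (\<phi> \<circ> cond_exp D)" for \<psi>
  define h where "h k = (\<Sum>j\<in>UNIV. eta (b k j))" for k
  \<comment> \<open>\<open>c\<close> collects the coefficients linear in \<open>q\<close>: those
    from the logarithms of the reference densities, plus \<open>h\<close>. Adding \<open>h\<close>
    here and subtracting it in \<open>t\<close> turns the remaining part into the gap of
    \<open>eta_mixture_le\<close>, which is at most zero.\<close>
  define c where "c k = h k - log0 (l k) + (\<Sum>j\<in>UNIV. b k j * log0 (P j))" for k
  have t: "t \<psi> = (\<Sum>j\<in>UNIV. eta (p \<psi> j)) - (\<Sum>k\<in>UNIV. eta (q \<psi> k)) - (\<Sum>k\<in>UNIV. q \<psi> k * h k)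
      + (\<Sum>k\<in>UNIV. q \<psi> k * c k)" if "positive_functional UNIV \<psi>" for \<psi>
  proof -
    have "rel_entropy D \<psi> \<phi> = (\<Sum>k\<in>UNIV. q \<psi> k * (log0 (q \<psi> k) - log0 (l k)))"
      unfolding D by (rule rel_entropy_masa[OF w lin[OF that] lin[OF pos] q[OF that] \<phi>_w l_nonneg])
    moreover have "rel_entropy (unitary_conj u D) (\<psi> \<circ> cond_exp D) (\<phi> \<circ> cond_exp D)
        = (\<Sum>j\<in>UNIV. p \<psi> j * (log0 (p \<psi> j) - log0 (P j)))"
      unfolding uD unfolding D using p[OF pos]
      by (intro rel_entropy_masa[OF v lin_E[OF that] lin_E[OF pos] p[OF that]]) (simp_all add: p\<phi>)
    moreover have "(\<Sum>j\<in>UNIV. p \<psi> j * log0 (P j)) = (\<Sum>k\<in>UNIV. q \<psi> k * (\<Sum>j\<in>UNIV. b k j * log0 (P j)))"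
      by (simp add: p_def sum_distrib_left sum_distrib_right mult_ac) (rule sum.swap)
    ultimately show ?thesis
      by (simp add: t_def c_def eta_log0 algebra_simps sum.distrib sum_subtractf sum_negf)
  qed
  have t_le: "t \<psi> \<le> (\<Sum>k\<in>UNIV. q \<psi> k * c k)" if "positive_functional UNIV \<psi>" for \<psi>
    using t[OF that] eta_mixture_le[of "q \<psi>" b] q(2)[OF that] b_nonneg b_row
    by (simp add: p_def h_def)
  \<comment> \<open>The diagonals of a decomposition add up to \<open>l\<close>, so the linear bound
    has the same total for every decomposition.\<close>
  have sum_q: "(\<Sum>\<psi>\<leftarrow>\<Psi>. \<Sum>k\<in>UNIV. q \<psi> k * c k) = (\<Sum>k\<in>UNIV. l k * c k)"
    if "\<Psi> \<in> decompositions \<phi>" for \<Psi>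
  proof -
    have "(\<Sum>\<psi>\<leftarrow>\<Psi>. q \<psi> k) = Re (\<Sum>\<psi>\<leftarrow>\<Psi>. \<psi> (dg w (ind k)))" for k
      by (induction \<Psi>) (simp_all add: q_def)
    then have "(\<Sum>\<psi>\<leftarrow>\<Psi>. q \<psi> k) = l k" for k
      using that by (simp add: decompositions_def \<phi>_w)
    then show ?thesis
      by (simp add: sum_list_sum_swap sum_list_mult_const)
  qed
  have rhs: "weighted_entropy l (transpose (b_matrix E u)) + vn_entropy D \<phi>
      - vn_entropy (unitary_conj u D) \<phi> = (\<Sum>k\<in>UNIV. l k * c k)"
  proof -
    have "(\<Sum>j\<in>UNIV. P j * log0 (P j)) = (\<Sum>k\<in>UNIV. l k * (\<Sum>j\<in>UNIV. b k j * log0 (P j)))"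
    proof -
      have "P j * log0 (P j) = (\<Sum>k\<in>UNIV. l k * (b k j * log0 (P j)))" for j
        by (subst P_def) (simp add: sum_distrib_left mult_ac)
      then show ?thesis
        by (simp add: sum_distrib_left) (rule sum.swap)
    qed
    then show ?thesis
      by (simp add: weighted_entropy_def transpose_def b_matrix S_D S_uD c_def h_def eta_log0
          algebra_simps sum.distrib sum_subtractf sum_negf)
  qed

  \<comment> \<open>A decomposition attaining the bound\<close>
  define \<xi> where "\<xi> i = (\<lambda>x. of_real (l i) * trace (dg w (ind i) ** x))" for i
  obtain xs :: "'n list" where xs: "set xs = UNIV" "distinct xs"
    using finite_distinct_list[OF finite] by blast
  have \<xi>_pos: "positive_functional UNIV (\<xi> i)" for i
    unfolding \<xi>_def by (rule positive_functional_trace_dg[OF w l_nonneg])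
  \<comment> \<open>The diagonal of each piece is concentrated at one index, the case in which the
    mixture inequality is an equality.\<close>
  have q\<xi>: "q (\<xi> i) = (\<lambda>k. if k = i then l i else 0)" for i
    by (auto simp: q_def \<xi>_def dg_mult[OF w] trace_dg[OF w] fun_eq_iff if_distrib[of "\<lambda>x. _ * x"]
        cong: if_cong)
  have "t (\<xi> i) = (\<Sum>k\<in>UNIV. q (\<xi> i) k * c k)" for i
    using t[OF \<xi>_pos] eta_mixture_eq_point[of "l i" b i] l_nonneg b_nonneg b_row
    by (simp only: p_def h_def q\<xi>)
  then have \<xi>_eq: "(\<Sum>\<psi>\<leftarrow>map \<xi> xs. t \<psi>) = (\<Sum>\<psi>\<leftarrow>map \<xi> xs. \<Sum>k\<in>UNIV. q \<psi> k * c k)"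
    by (simp add: comp_def)
  have "(\<Sum>\<psi>\<leftarrow>map \<xi> xs. \<psi> x) = \<phi> x" for x
    using xs by (simp add: comp_def \<xi>_def \<phi> trace_dg_mult[OF w] sum_list_distinct_conv_sum_set
        if_distrib[of "\<lambda>x. x * _"] cong: if_cong)
  then have \<xi>_dec: "map \<xi> xs \<in> decompositions \<phi>"
    using \<xi>_pos by (auto simp: decompositions_def)

  have "cond_rel_entropy \<phi> D (unitary_conj u D) = (SUP \<Psi>\<in>decompositions \<phi>. ereal (\<Sum>\<psi>\<leftarrow>\<Psi>. t \<psi>))"
    by (simp add: cond_rel_entropy_def t_def)
  also have "\<dots> = ereal (\<Sum>k\<in>UNIV. l k * c k)"
  proof (rule antisym)
    show "(SUP \<Psi>\<in>decompositions \<phi>. ereal (\<Sum>\<psi>\<leftarrow>\<Psi>. t \<psi>)) \<le> ereal (\<Sum>k\<in>UNIV. l k * c k)"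
    proof (rule SUP_least)
      fix \<Psi> assume \<Psi>: "\<Psi> \<in> decompositions \<phi>"
      then have "(\<Sum>\<psi>\<leftarrow>\<Psi>. t \<psi>) \<le> (\<Sum>\<psi>\<leftarrow>\<Psi>. \<Sum>k\<in>UNIV. q \<psi> k * c k)"
        by (intro sum_list_mono t_le) (auto simp: decompositions_def)
      then show "ereal (\<Sum>\<psi>\<leftarrow>\<Psi>. t \<psi>) \<le> ereal (\<Sum>k\<in>UNIV. l k * c k)"
        by (simp add: sum_q[OF \<Psi>])
    qed
    show "ereal (\<Sum>k\<in>UNIV. l k * c k) \<le> (SUP \<Psi>\<in>decompositions \<phi>. ereal (\<Sum>\<psi>\<leftarrow>\<Psi>. t \<psi>))"
      using SUP_upper[OF \<xi>_dec, of "\<lambda>\<Psi>. ereal (\<Sum>\<psi>\<leftarrow>\<Psi>. t \<psi>)"]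
      by (simp only: \<xi>_eq sum_q[OF \<xi>_dec])
  qed
  finally show ?thesis
    by (simp only: rhs)
qed

end
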